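(* Let $F = \langle x_0, x_1 \mid [x_0x_1^{-1},\, x_0^{-1}x_1x_0],\ [x_0x_1^{-1},\, x_0^{-2}x_1x_0^{2}]\rangle$ be Thompson's group $F$ with its standard generating set $X=\{x_0,x_1\}$. Then $F$ contains seesaw words of arbitrarily large swing with respect to the generator $x_0$ in the generating set $X$; that is, for every positive integer $K$ there exist an integer $k \ge K$ and an element $w \in F$ such that $w$ is a seesaw word of swing $k$ with respect to $x_0$ (for the generating set $X$).
   Context: For a group $G$ with finite generating set $X$, $|w|$ denotes the word length of $w\in G$ with respect to $X$ (the minimal length of an expression of $w$ as a product of elements of $X\cup X^{-1}$). Definition. Let $G$ be a group with finite generating set $X$, let $g \in X$ and let $k\ge 1$ be an integer. An element $w\in G$ is a seesaw word of swing $k$ with respect to $g$ (for $X$) if the following hold: (1) $|wg| = |wg^{-1}| = |w|-1$, and for all $h\in X\cup X^{-1}$ with $h\ne g, g^{-1}$ one has $|wh|\ge |w|$. (2) $|wg^{l}| = |wg^{l-1}|-1$ for every integer $l\in[1,k]$, and $|wg^{m}h|\ge |wg^{m}|$ for every integer $m\in[1,k-1]$ and every $h\in X\cup X^{-1}$ with $h\neq g$. (3) $|wg^{-l}| = |wg^{-l+1}|-1$ for every integer $l\in[1,k]$, and $|wg^{-m}h|\ge |wg^{-m}|$ for every integer $m\in[1,k-1]$ and every $h\in X\cup X^{-1}$ with $h\neq g^{-1}$. *)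

theory Defs
  imports "HOL-Algebra.Generated_Groups"
begin

section \<open>Free groups\<close>

text \<open>
  A letter \<open>(a, True)\<close> stands for the generator \<open>a\<close> and \<open>(a, False)\<close> for its formal inverse. The
  free group on the elements of the type \<open>'a\<close> consists of the words in these letters modulo
  insertion and deletion of adjacent mutually inverse letters.
\<close>

inductive free_eq :: "('a \<times> bool) list \<Rightarrow> ('a \<times> bool) list \<Rightarrow> bool" where
  cancel: "free_eq (u @ [(a, e), (a, \<not> e)] @ v) (u @ v)"
| refl: "free_eq u u"
| sym: "free_eq u v \<Longrightarrow> free_eq v u"
| trans: "free_eq u v \<Longrightarrow> free_eq v w \<Longrightarrow> free_eq u w"

definition free_rel :: "('a \<times> bool) list rel" where
  "free_rel = {(u, v). free_eq u v}"

definition free_group :: "('a \<times> bool) list set monoid" where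
  "free_group = \<lparr>carrier = UNIV // free_rel,
     monoid.mult = (\<lambda>A B. \<Union>u\<in>A. \<Union>v\<in>B. free_rel `` {u @ v}),
     one = free_rel `` {[]}\<rparr>"

definition free_gen :: "'a \<Rightarrow> ('a \<times> bool) list set" where
  "free_gen a = free_rel `` {[(a, True)]}"

lemma equiv_free_rel: "equiv UNIV free_rel"
  unfolding equiv_def refl_on_def sym_def trans_def free_rel_def
  by (auto intro: free_eq.intros)

lemma free_eq_append_left: "free_eq u v \<Longrightarrow> free_eq (w @ u) (w @ v)"
proof (induction rule: free_eq.induct)
  case (cancel u a e v)
  show ?case using free_eq.cancel[of "w @ u" a e v] by simp
qed (auto intro: free_eq.intros)

lemma free_eq_append_right: "free_eq u v \<Longrightarrow> free_eq (u @ w) (v @ w)"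
proof (induction rule: free_eq.induct)
  case (cancel u a e v)
  show ?case using free_eq.cancel[of u a e "v @ w"] by simp
qed (auto intro: free_eq.intros)

lemma free_eq_append: "free_eq u u' \<Longrightarrow> free_eq v v' \<Longrightarrow> free_eq (u @ v) (u' @ v')"
  by (meson free_eq.trans free_eq_append_left free_eq_append_right)

lemma free_class_eq_iff: "free_rel `` {u} = free_rel `` {v} \<longleftrightarrow> free_eq u v"
  using eq_equiv_class_iff[OF equiv_free_rel] by (auto simp: free_rel_def)

lemma free_class_carrier [simp, intro]: "free_rel `` {u} \<in> carrier free_group"
  by (simp add: free_group_def quotientI)

lemma free_carrierE:
  assumes "A \<in> carrier free_group" obtains u where "A = free_rel `` {u}"
  using assms by (auto simp: free_group_def elim: quotientE)

lemma free_mult_class: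
  "free_rel `` {u} \<otimes>\<^bsub>free_group\<^esub> free_rel `` {v} = free_rel `` {u @ v}"
proof -
  have "congruent2 free_rel free_rel (\<lambda>u v. free_rel `` {u @ v})"
    unfolding congruent2_def free_class_eq_iff by (auto simp: free_rel_def intro: free_eq_append)
  from UN_equiv_class2[OF equiv_free_rel equiv_free_rel this]
  show ?thesis by (simp add: free_group_def)
qed

lemma free_one_class: "\<one>\<^bsub>free_group\<^esub> = free_rel `` {[]}"
  by (simp add: free_group_def)

definition word_inv :: "('a \<times> bool) list \<Rightarrow> ('a \<times> bool) list" where
  "word_inv w = rev (map (\<lambda>(a, e). (a, \<not> e)) w)"

lemma free_eq_word_inv: "free_eq (word_inv w @ w) []"
proof (induction w)
  case (Cons x w)
  obtain a e where x: "x = (a, e)" by (cases x)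
  have "free_eq (word_inv w @ [(a, \<not> e), (a, \<not> \<not> e)] @ w) (word_inv w @ w)"
    by (rule free_eq.cancel)
  with Cons show ?case by (auto simp: x word_inv_def intro: free_eq.trans)
qed (simp add: word_inv_def free_eq.refl)

theorem group_free_group: "group free_group"
proof (rule groupI)
  fix A :: "('a \<times> bool) list set" assume "A \<in> carrier free_group"
  then obtain u where u: "A = free_rel `` {u}" by (rule free_carrierE)
  show "\<exists>B\<in>carrier free_group. B \<otimes>\<^bsub>free_group\<^esub> A = \<one>\<^bsub>free_group\<^esub>"
    by (rule bexI[of _ "free_rel `` {word_inv u}"])
      (auto simp: u free_mult_class free_one_class free_class_eq_iff free_eq_word_inv)
qed (auto elim!: free_carrierE simp: free_mult_class free_one_class)

lemma free_inv_class: "inv\<^bsub>free_group\<^esub> (free_rel `` {u}) = free_rel `` {word_inv u}"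
  by (rule group.inv_equality[OF group_free_group])
    (auto simp: free_mult_class free_one_class free_class_eq_iff free_eq_word_inv)

lemma generate_free_group: "generate free_group (range free_gen) = carrier free_group"
proof
  interpret group "free_group :: ('a \<times> bool) list set monoid" by (rule group_free_group)
  show "generate free_group (range free_gen) \<subseteq> carrier (free_group :: ('a \<times> bool) list set monoid)"
    by (rule generate_incl) (auto simp: free_gen_def)
  have *: "free_rel `` {w} \<in> generate free_group (range free_gen)" for w :: "('a \<times> bool) list"
  proof (induction w)
    case Nil
    show ?case using generate.one[of free_group] by (simp add: free_one_class)
  next
    case (Cons x w)
    obtain a e where x: "x = (a, e)" by (cases x)
    have "free_rel `` {[x]} \<in> generate free_group (range free_gen)"
    proof (cases e)
      case True
      then show ?thesis by (auto simp: x free_gen_def intro: generate.incl)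
    next
      case False
      then have "free_rel `` {[x]} = inv\<^bsub>free_group\<^esub> (free_gen a)"
        by (simp add: x free_gen_def free_inv_class word_inv_def)
      then show ?thesis by (auto intro: generate.inv)
    qed
    from generate.eng[OF this Cons] show ?case by (simp add: free_mult_class)
  qed
  show "carrier free_group \<subseteq> generate free_group (range (free_gen :: 'a \<Rightarrow> _))"
    by (auto elim!: free_carrierE intro: *)
qed


section \<open>Group presentations\<close>

definition normal_closure :: "('g, 'm) monoid_scheme \<Rightarrow> 'g set \<Rightarrow> 'g set" where
  "normal_closure G R =
     generate G {g \<otimes>\<^bsub>G\<^esub> r \<otimes>\<^bsub>G\<^esub> inv\<^bsub>G\<^esub> g | g r. g \<in> carrier G \<and> r \<in> R}"

definition presented_group :: "('a \<times> bool) list set set \<Rightarrow> ('a \<times> bool) list set set monoid" where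
  "presented_group R = free_group Mod normal_closure free_group R"

definition presented_gen :: "('a \<times> bool) list set set \<Rightarrow> 'a \<Rightarrow> ('a \<times> bool) list set set" where
  "presented_gen R a = normal_closure free_group R #>\<^bsub>free_group\<^esub> free_gen a"

lemma (in group) normal_closure_normal:
  assumes "R \<subseteq> carrier G" shows "normal_closure G R \<lhd> G"
  unfolding normal_closure_def
proof (rule normal_generateI)
  show "{g \<otimes> r \<otimes> inv g | g r. g \<in> carrier G \<and> r \<in> R} \<subseteq> carrier G"
    using assms by auto
next
  fix h g assume "h \<in> {g \<otimes> r \<otimes> inv g | g r. g \<in> carrier G \<and> r \<in> R}" and g: "g \<in> carrier G"
  then obtain g' r where h: "h = g' \<otimes> r \<otimes> inv g'" "g' \<in> carrier G" "r \<in> R" by blast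
  have "g \<otimes> h \<otimes> inv g = (g \<otimes> g') \<otimes> r \<otimes> inv (g \<otimes> g')"
    using h g assms by (auto simp: subset_iff m_assoc inv_mult_group)
  then show "g \<otimes> h \<otimes> inv g \<in> {g \<otimes> r \<otimes> inv g | g r. g \<in> carrier G \<and> r \<in> R}"
    using h g by blast
qed

lemma group_presented_group: "R \<subseteq> carrier free_group \<Longrightarrow> group (presented_group R)"
  unfolding presented_group_def
  by (intro normal.factorgroup_is_group group.normal_closure_normal group_free_group)

lemma generate_presented_group:
  assumes "R \<subseteq> carrier free_group"
  shows "generate (presented_group R) (range (presented_gen R)) = carrier (presented_group R)"
proof -
  define N where "N = normal_closure free_group R"
  have N: "N \<lhd> free_group"
    unfolding N_def by (intro group.normal_closure_normal group_free_group assms)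
  have P: "presented_group R = free_group Mod N" by (simp add: presented_group_def N_def)
  interpret h: group_hom free_group "free_group Mod N" "\<lambda>a. N #>\<^bsub>free_group\<^esub> a"
    using N by (simp add: group_hom_def group_hom_axioms_def group_free_group
        normal.factorgroup_is_group normal.r_coset_hom_Mod)
  have "range (free_gen :: 'a \<Rightarrow> _) \<subseteq> carrier free_group" by (auto simp: free_gen_def)
  from h.generate_img[OF this]
  have "generate (free_group Mod N) ((\<lambda>a. N #>\<^bsub>free_group\<^esub> a) ` range free_gen) =
      (\<lambda>a. N #>\<^bsub>free_group\<^esub> a) ` carrier free_group"
    by (simp add: generate_free_group)
  also have "\<dots> = carrier (free_group Mod N)"
    by (auto simp: FactGroup_def RCOSETS_def)
  also have "(\<lambda>a. N #>\<^bsub>free_group\<^esub> a) ` range free_gen = range (presented_gen R)"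
    by (auto simp: presented_gen_def N_def)
  finally show ?thesis by (simp add: P)
qed


section \<open>Thompson's group F\<close>

definition commutator :: "('g, 'm) monoid_scheme \<Rightarrow> 'g \<Rightarrow> 'g \<Rightarrow> 'g" where
  "commutator G a b = a \<otimes>\<^bsub>G\<^esub> b \<otimes>\<^bsub>G\<^esub> inv\<^bsub>G\<^esub> a \<otimes>\<^bsub>G\<^esub> inv\<^bsub>G\<^esub> b"

datatype F_gen = X0 | X1

definition F_relators :: "(F_gen \<times> bool) list set set" where
  "F_relators =
    (let G = free_group; a = free_gen X0; b = free_gen X1 in
      {commutator G (a \<otimes>\<^bsub>G\<^esub> inv\<^bsub>G\<^esub> b) (inv\<^bsub>G\<^esub> a \<otimes>\<^bsub>G\<^esub> b \<otimes>\<^bsub>G\<^esub> a),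
       commutator G (a \<otimes>\<^bsub>G\<^esub> inv\<^bsub>G\<^esub> b)
         (a [^]\<^bsub>G\<^esub> (- 2 :: int) \<otimes>\<^bsub>G\<^esub> b \<otimes>\<^bsub>G\<^esub> a [^]\<^bsub>G\<^esub> (2::int))})"

definition thompson_F :: "(F_gen \<times> bool) list set set monoid" where
  "thompson_F = presented_group F_relators"

definition F_x0 :: "(F_gen \<times> bool) list set set" where
  "F_x0 = presented_gen F_relators X0"

definition F_x1 :: "(F_gen \<times> bool) list set set" where
  "F_x1 = presented_gen F_relators X1"

lemma F_relators_carrier: "F_relators \<subseteq> carrier free_group"
proof -
  interpret group "free_group :: (F_gen \<times> bool) list set monoid" by (rule group_free_group)
  have "free_gen x \<in> carrier free_group" for x :: F_gen by (simp add: free_gen_def)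
  then show ?thesis by (simp add: F_relators_def commutator_def Let_def)
qed

lemma group_thompson_F: "group thompson_F"
  unfolding thompson_F_def by (rule group_presented_group[OF F_relators_carrier])

lemma generate_thompson_F: "generate thompson_F {F_x0, F_x1} = carrier thompson_F"
proof -
  have "(UNIV :: F_gen set) = {X0, X1}" using F_gen.exhaust by auto
  then have "range f = {f X0, f X1}" for f :: "F_gen \<Rightarrow> (F_gen \<times> bool) list set set"
    by (metis image_insert image_empty)
  then show ?thesis
    using generate_presented_group[OF F_relators_carrier]
    by (simp add: thompson_F_def F_x0_def F_x1_def)
qed


section \<open>Word length and seesaw words\<close>

definition gens_and_invs :: "('g, 'm) monoid_scheme \<Rightarrow> 'g set \<Rightarrow> 'g set" where
  "gens_and_invs G X = X \<union> (\<lambda>x. inv\<^bsub>G\<^esub> x) ` X"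

text \<open>Meaningful for \<open>w\<close> in the subgroup generated by \<open>X\<close>; otherwise the \<open>LEAST\<close> is unspecified.\<close>

definition word_length :: "('g, 'm) monoid_scheme \<Rightarrow> 'g set \<Rightarrow> 'g \<Rightarrow> nat" where
  "word_length G X w =
     (LEAST n. \<exists>hs. length hs = n \<and> set hs \<subseteq> gens_and_invs G X \<and> foldr (monoid.mult G) hs \<one>\<^bsub>G\<^esub> = w)"

text \<open>
  To be used for a group \<open>G\<close> with a finite generating set \<open>X\<close>. Lengths are compared as integers to
  avoid truncated subtraction.
\<close>

definition seesaw_word ::
  "('g, 'm) monoid_scheme \<Rightarrow> 'g set \<Rightarrow> 'g \<Rightarrow> int \<Rightarrow> 'g \<Rightarrow> bool" where
  "seesaw_word G X g k w \<longleftrightarrow>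
    (let len = (\<lambda>v. int (word_length G X v)); Y = gens_and_invs G X in
      g \<in> X \<and> k \<ge> 1 \<and> w \<in> carrier G \<and>
      (len (w \<otimes>\<^bsub>G\<^esub> g) = len w - 1 \<and>
       len (w \<otimes>\<^bsub>G\<^esub> inv\<^bsub>G\<^esub> g) = len w - 1 \<and>
       (\<forall>h\<in>Y. h \<noteq> g \<and> h \<noteq> inv\<^bsub>G\<^esub> g \<longrightarrow> len (w \<otimes>\<^bsub>G\<^esub> h) \<ge> len w)) \<and>
      ((\<forall>l\<in>{1..k}. len (w \<otimes>\<^bsub>G\<^esub> g [^]\<^bsub>G\<^esub> l) = len (w \<otimes>\<^bsub>G\<^esub> g [^]\<^bsub>G\<^esub> (l - 1)) - 1) \<and>
       (\<forall>m\<in>{1..k - 1}. \<forall>h\<in>Y. h \<noteq> g \<longrightarrow>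
          len (w \<otimes>\<^bsub>G\<^esub> g [^]\<^bsub>G\<^esub> m \<otimes>\<^bsub>G\<^esub> h) \<ge> len (w \<otimes>\<^bsub>G\<^esub> g [^]\<^bsub>G\<^esub> m))) \<and>
      ((\<forall>l\<in>{1..k}. len (w \<otimes>\<^bsub>G\<^esub> g [^]\<^bsub>G\<^esub> (- l)) = len (w \<otimes>\<^bsub>G\<^esub> g [^]\<^bsub>G\<^esub> (- l + 1)) - 1) \<and>
       (\<forall>m\<in>{1..k - 1}. \<forall>h\<in>Y. h \<noteq> inv\<^bsub>G\<^esub> g \<longrightarrow>
          len (w \<otimes>\<^bsub>G\<^esub> g [^]\<^bsub>G\<^esub> (- m) \<otimes>\<^bsub>G\<^esub> h) \<ge> len (w \<otimes>\<^bsub>G\<^esub> g [^]\<^bsub>G\<^esub> (- m)))))"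

end

theory Submission
  imports Defs Complex_Main
begin

text \<open>
  Think of an element of \<open>F\<close> as a row of binary trees indexed by the integers, with a
  pointer at one of them: \<open>x0\<^sup>-\<^sup>1\<close> moves the pointer to the next tree on the right, \<open>x0\<close> to the next on the
  left, \<open>x1\<^sup>-\<^sup>1\<close> joins the current tree to its right neighbour, and \<open>x1\<close> undoes such a join. The
  seesaw word \<open>w\<close> of swing \<open>k\<close> makes one join \<open>k + 1\<close> steps to the left of the origin and \<open>k + 1\<close> joins on
  consecutive pairs of leaves to the right of it, and then takes the pointer back to the origin. The
  left half and the right half commute, so either may be built first. Hence the pointer may arrive at
  the tree \<open>l\<close> steps from the origin, on either side, with \<open>\<bar>l\<bar>\<close> letters fewer than it needs for the
  origin itself, and \<open>w x0\<^sup>l\<close> has length \<open>5 k + 3 - \<bar>l\<bar>\<close> whenever \<open>\<bar>l\<bar> \<le> k\<close>. That the halves commute in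
  the presented group is \<open>left_right_commute\<close>.

  For the lower bounds, make the picture an action of \<open>F\<close> on the real line: \<open>x0\<close> is the translation by \<open>1\<close> and
  \<open>x1\<^sup>-\<^sup>1\<close> squeezes \<open>[0, 2]\<close> to \<open>[0, 1]\<close> and translates what lies to the right. A word acts by its letters
  in turn, so multiplication by a generator on the right composes its map after the others. Let \<open>q j\<close>
  be the image of the integer \<open>j\<close>. The trees are the unit intervals, with the pointer at \<open>[0, 1]\<close>, and
  \<open>j\<close> is the gap between two adjacent leaves, which separates two trees if \<open>q j\<close> is an integer and lies
  inside a tree otherwise. The function \<open>cost\<close> charges every gap: one unit if it has been closed by a
  join, and the number of moves across it that building the configuration requires; this follows the
  length formula of Belk and Brown for forest diagrams. A letter changes the charge only at the gap
  with \<open>q j = 1\<close> (before or after the letter), the one next to the pointer, and there by at most \<open>1\<close>.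
  So the total charge over any finite set of gaps bounds the word length from below
  (\<open>potential_le_word_length\<close>).

  The total charge of \<open>w\<close> is \<open>5 k + 3\<close>, and \<open>x1\<close> and its
  inverse do not lower the charge of \<open>w x0\<^sup>l\<close> for \<open>\<bar>l\<bar> < k\<close>. This is what the pairs on the right are for.
  If all trees there were single leaves, a join could replace the first move across a gap and save the
  move back; a right neighbour that is itself a pair has to be visited before it can be joined.
\<close>


section \<open>Words in the generators\<close>

definition F_elem :: "(F_gen \<times> bool) list \<Rightarrow> (F_gen \<times> bool) list set set" where
  "F_elem u = normal_closure free_group F_relators #>\<^bsub>free_group\<^esub> (free_rel `` {u})"

lemma normal_F_relators: "normal_closure free_group F_relators \<lhd> free_group"
  by (intro group.normal_closure_normal group_free_group F_relators_carrier)

lemma F_elem_append: "F_elem (u @ v) = F_elem u \<otimes>\<^bsub>thompson_F\<^esub> F_elem v"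
  unfolding F_elem_def thompson_F_def presented_group_def FactGroup_def
  by (simp add: normal.rcos_sum[OF normal_F_relators] free_mult_class)

lemma F_elem_carrier [simp, intro]: "F_elem u \<in> carrier thompson_F"
  unfolding F_elem_def thompson_F_def presented_group_def FactGroup_def RCOSETS_def by auto

lemma F_elem_free_eq: "free_eq u v \<Longrightarrow> F_elem u = F_elem v"
  unfolding F_elem_def using free_class_eq_iff[of u v] by simp

lemma F_elem_Nil: "F_elem [] = \<one>\<^bsub>thompson_F\<^esub>"
proof -
  interpret group thompson_F by (rule group_thompson_F)
  have "F_elem [] \<otimes>\<^bsub>thompson_F\<^esub> F_elem [] = F_elem []"
    using F_elem_append[of "[]" "[]"] by simp
  then show ?thesis by (simp add: l_cancel_one')
qed

lemma F_elem_x0: "F_elem [(X0, True)] = F_x0" and F_elem_x1: "F_elem [(X1, True)] = F_x1"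
  by (simp_all add: F_elem_def F_x0_def F_x1_def presented_gen_def free_gen_def)

lemma F_elem_inverse: "F_elem [(x, False)] = inv\<^bsub>thompson_F\<^esub> F_elem [(x, True)]"
proof -
  interpret group thompson_F by (rule group_thompson_F)
  have "free_eq ([] @ [(x, False), (x, \<not> False)] @ []) ([] @ [])" by (rule free_eq.cancel)
  then have "F_elem [(x, False)] \<otimes>\<^bsub>thompson_F\<^esub> F_elem [(x, True)] = \<one>\<^bsub>thompson_F\<^esub>"
    using F_elem_free_eq F_elem_Nil by (simp add: F_elem_append[symmetric])
  from inv_equality[OF this] show ?thesis by simp
qed

lemma gens_and_invs_F:
  "gens_and_invs thompson_F {F_x0, F_x1} =
    {F_elem [(X0, True)], F_elem [(X0, False)], F_elem [(X1, True)], F_elem [(X1, False)]}"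
  by (auto simp: gens_and_invs_def F_elem_inverse F_elem_x0 F_elem_x1)

lemma F_elem_foldr: "F_elem u = foldr (\<otimes>\<^bsub>thompson_F\<^esub>) (map (\<lambda>s. F_elem [s]) u) \<one>\<^bsub>thompson_F\<^esub>"
  by (induction u) (simp_all add: F_elem_Nil, metis F_elem_append append_Cons append_Nil)

lemma F_letter_gens: "F_elem [s] \<in> gens_and_invs thompson_F {F_x0, F_x1}"
  by (cases s rule: prod.exhaust; cases "fst s"; cases "snd s") (auto simp: gens_and_invs_F)

text \<open>
  The Cayley graph only sees products of generators, and these are the images of the words; so the
  length can be computed by comparing words.
\<close>

lemma word_length_F_elem:
  "word_length thompson_F {F_x0, F_x1} (F_elem u) = (LEAST n. \<exists>v. length v = n \<and> F_elem v = F_elem u)"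
proof -
  have "(\<exists>hs. length hs = n \<and> set hs \<subseteq> gens_and_invs thompson_F {F_x0, F_x1} \<and>
      foldr (\<otimes>\<^bsub>thompson_F\<^esub>) hs \<one>\<^bsub>thompson_F\<^esub> = F_elem u) \<longleftrightarrow> (\<exists>v. length v = n \<and> F_elem v = F_elem u)"
    (is "?L \<longleftrightarrow> ?R") for n
  proof
    assume ?L
    then obtain hs where hs: "length hs = n" "set hs \<subseteq> gens_and_invs thompson_F {F_x0, F_x1}"
      "foldr (\<otimes>\<^bsub>thompson_F\<^esub>) hs \<one>\<^bsub>thompson_F\<^esub> = F_elem u" by blast
    have "gens_and_invs thompson_F {F_x0, F_x1} \<subseteq> range (\<lambda>s. F_elem [s])"
      by (auto simp: gens_and_invs_F)
    then have "hs \<in> lists (range (\<lambda>s. F_elem [s]))" using hs(2) by auto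
    then obtain v where "hs = map (\<lambda>s. F_elem [s]) v" by (auto simp: lists_image)
    then show ?R using hs F_elem_foldr[of v] by auto
  next
    assume ?R
    then obtain v where "length v = n" "F_elem v = F_elem u" by blast
    then show ?L using F_letter_gens
      by (intro exI[of _ "map (\<lambda>s. F_elem [s]) v"]) (auto simp flip: F_elem_foldr)
  qed
  then show ?thesis by (simp add: word_length_def)
qed

lemma word_length_le: "F_elem v = F_elem u \<Longrightarrow> word_length thompson_F {F_x0, F_x1} (F_elem u) \<le> length v"
  unfolding word_length_F_elem by (rule Least_le) blast

lemma word_length_attained:
  obtains v where "length v = word_length thompson_F {F_x0, F_x1} (F_elem u)" "F_elem v = F_elem u"
  using LeastI_ex[of "\<lambda>n. \<exists>v. length v = n \<and> F_elem v = F_elem u"]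
  unfolding word_length_F_elem by blast


section \<open>The action on the real line\<close>

definition join_map :: "real \<Rightarrow> real" where
  "join_map t = (if t \<le> 0 then t else if t \<le> 2 then t / 2 else t - 1)"

definition cut_map :: "real \<Rightarrow> real" where
  "cut_map t = (if t \<le> 0 then t else if t \<le> 1 then 2 * t else t + 1)"

fun letter_map :: "F_gen \<times> bool \<Rightarrow> real \<Rightarrow> real" where
  "letter_map (X0, True) t = t + 1"
| "letter_map (X0, False) t = t - 1"
| "letter_map (X1, True) t = cut_map t"
| "letter_map (X1, False) t = join_map t"

text \<open>
  The first letter acts first, so appending a letter to a word composes on the left.
\<close>

definition word_map :: "(F_gen \<times> bool) list \<Rightarrow> real \<Rightarrow> real" where
  "word_map u = fold letter_map u"

lemma word_map_simps [simp]:
  "word_map [] = id" "word_map (s # u) = word_map u \<circ> letter_map s"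
  "word_map (u @ v) = word_map v \<circ> word_map u"
  by (simp_all add: word_map_def)

lemma join_cut [simp]: "join_map (cut_map t) = t" "cut_map (join_map t) = t"
  by (auto simp: join_map_def cut_map_def)

lemma letter_map_inverse [simp]: "letter_map (x, \<not> e) (letter_map (x, e) t) = t"
  by (cases x; cases e) auto

lemma word_map_free_eq: "free_eq u v \<Longrightarrow> word_map u = word_map v"
  by (induction rule: free_eq.induct) (auto simp: fun_eq_iff)

lemma word_map_word_inv: "word_map (word_inv z) (word_map z t) = t"
  "word_map z (word_map (word_inv z) t) = t"
proof -
  have z: "word_inv (word_inv z) = z" by (induction z) (auto simp: word_inv_def)
  have *: "word_map u (word_map (word_inv u) t) = t" for u t
    using word_map_free_eq[OF free_eq_word_inv[of u]] by (simp add: fun_eq_iff)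
  show "word_map (word_inv z) (word_map z t) = t" "word_map z (word_map (word_inv z) t) = t"
    using *[of z] *[of "word_inv z"] by (simp_all add: z)
qed

text \<open>
  Both relators of \<open>F\<close> are commutators of a map supported on the left of \<open>1\<close> with one supported on the
  right of \<open>1\<close>.
\<close>

lemma word_map_commutator:
  assumes "\<And>t. t \<ge> 1 \<Longrightarrow> word_map u t = t" "\<And>t. t \<le> 1 \<Longrightarrow> word_map u t \<le> 1"
    and "\<And>t. t \<le> 1 \<Longrightarrow> word_map v t = t" "\<And>t. t \<ge> 1 \<Longrightarrow> word_map v t \<ge> 1"
  shows "word_map (u @ v @ word_inv u @ word_inv v) = id"
proof
  fix t
  have "word_map v (word_map u t) = word_map u (word_map v t)"
    using assms by (cases "t \<ge> 1") simp_all
  then show "word_map (u @ v @ word_inv u @ word_inv v) t = id t"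
    by (simp add: word_map_word_inv)
qed

lemma F_relators_words:
  "F_relators =
    (let u = [(X0, True), (X1, False)]; v = [(X0, False), (X1, True), (X0, True)];
         v' = [(X0, False), (X0, False), (X1, True), (X0, True), (X0, True)]
     in {free_rel `` {u @ v @ word_inv u @ word_inv v}, free_rel `` {u @ v' @ word_inv u @ word_inv v'}})"
proof -
  interpret group "free_group :: (F_gen \<times> bool) list set monoid" by (rule group_free_group)
  have gen: "free_gen x = free_rel `` {[(x, True)]}" for x :: F_gen by (simp add: free_gen_def)
  have pow: "A [^]\<^bsub>free_group\<^esub> (2::int) = A \<otimes>\<^bsub>free_group\<^esub> A"
    "A [^]\<^bsub>free_group\<^esub> (- 2::int) = inv\<^bsub>free_group\<^esub> (A \<otimes>\<^bsub>free_group\<^esub> A)"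
    if "A \<in> carrier free_group" for A :: "(F_gen \<times> bool) list set"
    using that by (simp_all add: int_pow_neg_int int_pow_def2 numeral_2_eq_2)
  show ?thesis
    by (simp add: F_relators_def commutator_def Let_def gen pow free_mult_class free_inv_class word_inv_def)
qed

lemma F_relators_word_map:
  assumes "r \<in> F_relators" shows "\<exists>z. r = free_rel `` {z} \<and> word_map z = id"
proof -
  let ?u = "[(X0, True), (X1, False)]"
  let ?v = "[(X0, False), (X1, True), (X0, True)]"
  let ?v' = "[(X0, False), (X0, False), (X1, True), (X0, True), (X0, True)]"
  have "word_map (?u @ ?v @ word_inv ?u @ word_inv ?v) = id"
    by (rule word_map_commutator) (auto simp: join_map_def cut_map_def)
  moreover have "word_map (?u @ ?v' @ word_inv ?u @ word_inv ?v') = id"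
    by (rule word_map_commutator) (auto simp: join_map_def cut_map_def)
  ultimately show ?thesis using assms unfolding F_relators_words Let_def by blast
qed

lemma normal_closure_word_map:
  assumes "A \<in> normal_closure free_group F_relators"
  shows "\<exists>z. A = free_rel `` {z} \<and> word_map z = id"
proof -
  have conj: "\<exists>z. g \<otimes>\<^bsub>free_group\<^esub> r \<otimes>\<^bsub>free_group\<^esub> inv\<^bsub>free_group\<^esub> g = free_rel `` {z} \<and> word_map z = id"
    if g: "g \<in> carrier free_group" and r: "r \<in> F_relators" for g r
  proof -
    obtain x where x: "g = free_rel `` {x}" using g by (rule free_carrierE)
    obtain z where z: "r = free_rel `` {z}" "word_map z = id" using F_relators_word_map[OF r] by blast
    show ?thesis using z
      by (intro exI[of _ "x @ z @ word_inv x"])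
        (auto simp: x free_mult_class free_inv_class fun_eq_iff word_map_word_inv)
  qed
  show ?thesis using assms unfolding normal_closure_def
  proof (induction rule: generate.induct)
    case one
    show ?case by (rule exI[of _ "[]"]) (simp add: free_one_class)
  next
    case (incl h)
    then show ?case using conj by blast
  next
    case (inv h)
    then obtain z where "h = free_rel `` {z}" "word_map z = id" using conj by blast
    then show ?case using word_map_word_inv[of z]
      by (intro exI[of _ "word_inv z"]) (auto simp: free_inv_class fun_eq_iff)
  next
    case (eng h1 h2)
    then obtain z1 z2 where "h1 = free_rel `` {z1}" "h2 = free_rel `` {z2}"
      "word_map z1 = id" "word_map z2 = id" by blast
    then show ?case by (intro exI[of _ "z1 @ z2"]) (simp add: free_mult_class)
  qed
qed

text \<open>
  The action factors through \<open>F\<close>. Two words with the same image differ by an element of the normal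
  closure of the relators, which acts trivially.
\<close>

lemma F_elem_word_map:
  assumes "F_elem u = F_elem v" shows "word_map u = word_map v"
proof -
  have "free_rel `` {u} \<in> normal_closure free_group F_relators #>\<^bsub>free_group\<^esub> free_rel `` {u}"
    by (rule group.rcos_self[OF group_free_group _ normal_imp_subgroup[OF normal_F_relators]]) simp
  then have "free_rel `` {u} \<in> normal_closure free_group F_relators #>\<^bsub>free_group\<^esub> free_rel `` {v}"
    using assms by (simp add: F_elem_def)
  then obtain A where "A \<in> normal_closure free_group F_relators"
    "free_rel `` {u} = A \<otimes>\<^bsub>free_group\<^esub> free_rel `` {v}" by (auto simp: r_coset_def)
  then obtain z where "word_map z = id" "free_rel `` {u} = free_rel `` {z @ v}"
    using normal_closure_word_map free_mult_class by metis
  then show ?thesis using word_map_free_eq[of u "z @ v"] by (simp add: free_class_eq_iff)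
qed

section \<open>A Lipschitz lower bound for the word length\<close>

text \<open>
  Let \<open>t = a / 2\<^sup>i\<close> with \<open>a\<close> odd be a gap inside a tree and \<open>t'\<close> the next gap. The join that closed \<open>t\<close> is
  the one whose right subtree occupies the dyadic interval \<open>[t, t + 2\<^sup>-\<^sup>i]\<close>. The gap is snug if \<open>t'\<close> is not
  inside this interval, that is, if this right subtree is a single leaf. If it is not, then some
  earlier join took place with the pointer to the right of \<open>t\<close>.
\<close>

definition snug :: "real \<Rightarrow> real \<Rightarrow> bool" where
  "snug t t' \<longleftrightarrow> (\<exists>(a::int) (i::nat). odd a \<and> t = of_int a / 2 ^ i \<and> of_int (a + 1) / 2 ^ i \<le> t')"

text \<open>
  A non-integer \<open>q j\<close> pays \<open>1\<close> for the join that closed the gap; all other charges are moves across the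
  gap. The pointer starts just to the right of the gap \<open>0\<close>, so it crosses a gap \<open>j \<le> 0\<close> in order to close
  it, for a total of \<open>2\<close>. To close a gap \<open>j > 0\<close> it need not cross it, unless the gap is not snug, when it
  has to go across and back, for a total of \<open>3\<close>. An open gap is crossed once if the starting position
  and the pointer lie on different sides of it. If they lie on the same side, it is crossed not at all
  or twice, according to whether everything beyond it is still untouched or not.
\<close>

definition cost :: "(int \<Rightarrow> real) \<Rightarrow> int \<Rightarrow> int" where
  "cost q j =
    (if q j \<notin> \<int> then (if j \<le> 0 then 2 else if snug (q j) (q (j + 1)) then 1 else 3)
     else if j \<le> 0 \<longleftrightarrow> q j > 0 then 1
     else if j \<le> 0 then (if \<forall>i\<le>j. q i = q j + of_int (i - j) then 0 else 2)
     else (if \<forall>i\<ge>j. q i = q j + of_int (i - j) then 0 else 2))"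

definition potential :: "int set \<Rightarrow> (int \<Rightarrow> real) \<Rightarrow> int" where
  "potential J q = (\<Sum>j\<in>J. cost q j)"

lemma potential_change:
  assumes "\<And>j. j \<in> J \<Longrightarrow> j \<noteq> i \<Longrightarrow> cost q' j = cost q j" "finite J"
  shows "potential J q' - potential J q = (if i \<in> J then cost q' i - cost q i else 0)"
proof (cases "i \<in> J")
  case True
  have "potential J q' = cost q' i + (\<Sum>j\<in>J - {i}. cost q' j)"
    "potential J q = cost q i + (\<Sum>j\<in>J - {i}. cost q j)"
    using True assms(2) by (simp_all add: potential_def sum.remove)
  moreover have "(\<Sum>j\<in>J - {i}. cost q' j) = (\<Sum>j\<in>J - {i}. cost q j)"
    using assms(1) by (intro sum.cong) auto
  ultimately show ?thesis using True by simp
next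
  case False
  then have "potential J q' = potential J q"
    using assms(1) unfolding potential_def by (intro sum.cong) auto
  then show ?thesis using False by simp
qed

lemma snug_shift:
  assumes "snug t t'" "t \<notin> \<int>" shows "snug (t + of_int m) (t' + of_int m)"
proof -
  obtain a i where a: "odd a" "t = of_int a / 2 ^ i" "of_int (a + 1) / 2 ^ i \<le> t'"
    using assms(1) unfolding snug_def by blast
  have "i \<noteq> 0" using a(2) assms(2) by (intro notI) auto
  then have "odd (a + m * 2 ^ i)" using a(1) by simp
  moreover have "t + of_int m = of_int (a + m * 2 ^ i) / 2 ^ i"
    "of_int (a + m * 2 ^ i + 1) / 2 ^ i \<le> t' + of_int m"
    using a(2,3) by (simp_all add: field_simps)
  ultimately show ?thesis unfolding snug_def by blast
qed

lemma snug_shift_iff: "t \<notin> \<int> \<Longrightarrow> snug (t + of_int m) (t' + of_int m) \<longleftrightarrow> snug t t'"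
  using snug_shift[of t t' m] snug_shift[of "t + of_int m" "t' + of_int m" "- m"] by auto

lemma cost_shift:
  assumes "q j \<noteq> 1" shows "cost (\<lambda>i. q i - 1) j = cost q j"
proof -
  have int: "q j - 1 \<in> \<int> \<longleftrightarrow> q j \<in> \<int>" using Ints_add Ints_diff by fastforce
  have sn: "snug (q j - 1) (q (j + 1) - 1) \<longleftrightarrow> snug (q j) (q (j + 1))" if "q j \<notin> \<int>"
    using snug_shift_iff[OF that, of "-1"] by simp
  have pos: "q j - 1 > 0 \<longleftrightarrow> q j > 0" if "q j \<in> \<int>"
    using that assms by (auto elim!: Ints_cases)
  have eq: "(q i - 1 = q j - 1 + of_int (i - j)) \<longleftrightarrow> (q i = q j + of_int (i - j))" for i by auto
  show ?thesis unfolding cost_def eq using int sn pos by (cases "q j \<in> \<int>") auto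
qed

lemma join_mono: "mono join_map" and cut_mono: "mono cut_map"
  by (auto simp: mono_def join_map_def cut_map_def)

lemma join_Ints: "t \<noteq> 1 \<Longrightarrow> join_map t \<in> \<int> \<longleftrightarrow> t \<in> \<int>"
proof (cases "0 < t \<and> t < 2")
  case True
  assume "t \<noteq> 1"
  then have "t \<notin> \<int>" "t / 2 \<notin> \<int>" using True by (auto elim!: Ints_cases)
  then show ?thesis using True by (simp add: join_map_def)
next
  case False
  have shift: "t - 1 \<in> \<int> \<longleftrightarrow> t \<in> \<int>" using Ints_add[of "t - 1" 1] by auto
  consider "t \<le> 0" | "t = 2" | "t > 2" using False by linarith
  then show ?thesis by cases (simp_all add: join_map_def shift)
qed

lemma snug_mono: "snug t t' \<Longrightarrow> t' \<le> t'' \<Longrightarrow> snug t t''"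
  unfolding snug_def using order_trans by blast

text \<open>
  A join and its inverse carry dyadic intervals that do not contain a breakpoint in their interior to
  dyadic intervals, and the interval in the definition of \<open>snug\<close> has integers only at its ends.
\<close>

lemma snug_join:
  assumes "snug t t'" "t \<notin> \<int>" shows "snug (join_map t) (join_map t')"
proof -
  obtain a i where a: "odd a" "t = of_int a / 2 ^ i" "of_int (a + 1) / 2 ^ i \<le> t'"
    using assms(1) unfolding snug_def by blast
  define t1 :: real where "t1 = of_int (a + 1) / 2 ^ i"
  have "snug t t1" unfolding snug_def t1_def using a by blast
  have "snug (join_map t) (join_map t1)"
  proof -
    consider "t < 0" | "0 < t" "t < 2" | "t > 2" using assms(2) by force
    then show ?thesis
    proof cases
      case 1
      then have "a + 1 \<le> 0" by (simp add: a(2) field_simps)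
      then have "t1 \<le> 0" unfolding t1_def by (intro divide_nonpos_pos) (simp_all del: of_int_add)
      then show ?thesis using \<open>snug t t1\<close> 1 by (simp add: join_map_def)
    next
      case 2
      then have "0 < a" by (simp add: a(2) field_simps)
      have "real_of_int a < of_int (2 * 2 ^ i)" using 2 by (simp add: a(2) field_simps)
      then have "a + 1 \<le> 2 * 2 ^ i" unfolding of_int_less_iff by simp
      then have "real_of_int (a + 1) \<le> of_int (2 * 2 ^ i)" unfolding of_int_le_iff .
      then have "t1 \<le> 2" "t1 > 0" using \<open>0 < a\<close> by (simp_all add: t1_def field_simps)
      then have "join_map t = of_int a / 2 ^ Suc i" "join_map t1 = of_int (a + 1) / 2 ^ Suc i"
        using 2 by (simp_all add: join_map_def a(2) t1_def)
      then show ?thesis unfolding snug_def using a(1) by (metis order_refl)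
    next
      case 3
      have "t \<le> t1" by (simp add: a(2) t1_def divide_right_mono)
      then show ?thesis using 3 snug_shift[OF \<open>snug t t1\<close> assms(2), of "-1"]
        by (simp add: join_map_def)
    qed
  qed
  moreover have "join_map t1 \<le> join_map t'" using a(3) by (intro monoD[OF join_mono]) (simp add: t1_def)
  ultimately show ?thesis by (rule snug_mono)
qed

lemma snug_cut:
  assumes "snug t t'" "t \<notin> \<int>" shows "snug (cut_map t) (cut_map t')"
proof -
  obtain a i where a: "odd a" "t = of_int a / 2 ^ i" "of_int (a + 1) / 2 ^ i \<le> t'"
    using assms(1) unfolding snug_def by blast
  have "i \<noteq> 0" using a(2) assms(2) by (intro notI) auto
  then obtain n where n: "i = Suc n" using not0_implies_Suc by blast
  define t1 :: real where "t1 = of_int (a + 1) / 2 ^ i"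
  have "snug t t1" unfolding snug_def t1_def using a by blast
  have "snug (cut_map t) (cut_map t1)"
  proof -
    consider "t < 0" | "0 < t" "t < 1" | "t > 1" using assms(2) by force
    then show ?thesis
    proof cases
      case 1
      then have "a + 1 \<le> 0" by (simp add: a(2) field_simps)
      then have "t1 \<le> 0" unfolding t1_def by (intro divide_nonpos_pos) (simp_all del: of_int_add)
      then show ?thesis using \<open>snug t t1\<close> 1 by (simp add: cut_map_def)
    next
      case 2
      then have "0 < a" by (simp add: a(2) field_simps)
      have "real_of_int a < of_int (2 ^ i)" using 2 by (simp add: a(2) field_simps)
      then have "a + 1 \<le> 2 ^ i" unfolding of_int_less_iff by simp
      then have "real_of_int (a + 1) \<le> of_int (2 ^ i)" unfolding of_int_le_iff .
      then have "t1 \<le> 1" "t1 > 0" using \<open>0 < a\<close> by (simp_all add: t1_def field_simps)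
      then have "cut_map t = of_int a / 2 ^ n" "cut_map t1 = of_int (a + 1) / 2 ^ n"
        using 2 by (simp_all add: cut_map_def a(2) t1_def n field_simps)
      then show ?thesis unfolding snug_def using a(1) by (metis order_refl)
    next
      case 3
      have "t \<le> t1" by (simp add: a(2) t1_def divide_right_mono)
      then show ?thesis using 3 snug_shift[OF \<open>snug t t1\<close> assms(2), of 1]
        by (simp add: cut_map_def)
    qed
  qed
  moreover have "cut_map t1 \<le> cut_map t'" using a(3) by (intro monoD[OF cut_mono]) (simp add: t1_def)
  ultimately show ?thesis by (rule snug_mono)
qed

text \<open>
  The map \<open>join_map\<close> is the identity on the left of \<open>0\<close> and a translation on the right of \<open>2\<close>. Hence the
  untouched regions that \<open>cost\<close> looks at stay untouched: they start at an integer \<open>q j \<noteq> 1\<close> and extend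
  away from the interval \<open>[0, 2]\<close>.
\<close>

lemma cost_join:
  assumes "strict_mono q" "q j \<noteq> 1" shows "cost (\<lambda>i. join_map (q i)) j = cost q j"
proof (cases "q j \<in> \<int>")
  case False
  have "snug (join_map (q j)) (join_map (q (j + 1))) \<longleftrightarrow> snug (q j) (q (j + 1))"
    using snug_join[of "q j" "q (j + 1)"] snug_cut[of "join_map (q j)" "join_map (q (j + 1))"]
      False join_Ints[OF assms(2)] by auto
  then show ?thesis using False join_Ints[OF assms(2)] by (simp add: cost_def)
next
  case True
  have pos: "join_map t > 0 \<longleftrightarrow> t > 0" for t by (auto simp: join_map_def)
  have left: "(\<forall>i\<le>j. join_map (q i) = join_map (q j) + of_int (i - j)) \<longleftrightarrow>
      (\<forall>i\<le>j. q i = q j + of_int (i - j))" if "q j \<le> 0"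
  proof -
    have "join_map (q i) = q i" if "i \<le> j" for i
      using strict_mono_less_eq[OF assms(1), of i j] that \<open>q j \<le> 0\<close> by (simp add: join_map_def)
    then show ?thesis by simp
  qed
  have right: "(\<forall>i\<ge>j. join_map (q i) = join_map (q j) + of_int (i - j)) \<longleftrightarrow>
      (\<forall>i\<ge>j. q i = q j + of_int (i - j))" if "q j > 0"
  proof -
    have "q j \<ge> 2" using True assms(2) that by (auto elim!: Ints_cases)
    then have "join_map (q i) = q i - 1" if "i \<ge> j" for i
      using strict_mono_less_eq[OF assms(1), of j i] that by (auto simp: join_map_def)
    then show ?thesis by simp
  qed
  show ?thesis
    using True join_Ints[OF assms(2)] left right unfolding cost_def pos by auto
qed

lemma cost_one:
  assumes "q j = 1"
  shows "cost q j = (if j \<le> 0 then 1 else if \<forall>i\<ge>j. q i = 1 + of_int (i - j) then 0 else 2)"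
  using assms by (simp add: cost_def)

lemma cost_half:
  assumes "q j = 1 / 2"
  shows "cost q j = (if j \<le> 0 then 2 else if snug (1 / 2) (q (j + 1)) then 1 else 3)"
proof -
  have half: "(1 / 2 :: real) \<notin> \<int>" by (auto elim!: Ints_cases)
  show ?thesis unfolding cost_def assms by (simp only: half simp_thms if_True)
qed

text \<open>
  The charge could jump from \<open>0\<close> to \<open>3\<close> only if everything to the right were untouched and the gap were
  not snug after the join. But an untouched right neighbour is a single leaf, which makes the gap snug.
\<close>

lemma cost_join_step:
  assumes "q j = 1" shows "\<bar>cost (\<lambda>i. join_map (q i)) j - cost q j\<bar> \<le> 1"
proof -
  have j: "join_map (q j) = 1 / 2" using assms by (simp add: join_map_def)
  have "snug (1 / 2) (join_map (q (j + 1)))" if "\<forall>i\<ge>j. q i = 1 + of_int (i - j)"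
  proof -
    have "q (j + 1) = 2" using that by simp
    then show ?thesis unfolding snug_def
      by (intro exI[of _ 1] exI[of _ "1::nat"]) (simp add: join_map_def)
  qed
  then show ?thesis using cost_one[of q j] cost_half[of "\<lambda>i. join_map (q i)" j] assms j by simp
qed

lemma cost_shift_step:
  assumes "q j = 1" shows "\<bar>cost (\<lambda>i. q i - 1) j - cost q j\<bar> \<le> 1"
  using assms by (simp add: cost_def)

lemma potential_join:
  assumes "strict_mono q" "finite J" "q i = 1"
  shows "potential J (\<lambda>i. join_map (q i)) - potential J q =
    (if i \<in> J then cost (\<lambda>i. join_map (q i)) i - cost q i else 0)"
  by (rule potential_change)
    (use assms strict_mono_eq[OF assms(1)] in \<open>auto intro!: cost_join simp flip: assms(3)\<close>)

text \<open>
  Since \<open>q\<close> is injective, at most one gap has \<open>q j = 1\<close>.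
\<close>

lemma potential_step_le:
  assumes "finite J" "strict_mono q"
    and other: "\<And>j. q j \<noteq> 1 \<Longrightarrow> cost q' j = cost q j"
    and step: "\<And>j. q j = 1 \<Longrightarrow> \<bar>cost q' j - cost q j\<bar> \<le> 1"
  shows "\<bar>potential J q' - potential J q\<bar> \<le> 1"
proof (cases "\<exists>i. q i = 1")
  case True
  then obtain i where i: "q i = 1" by blast
  have "q j \<noteq> 1" if "j \<noteq> i" for j using that i strict_mono_eq[OF assms(2), of j i] by simp
  then show ?thesis using potential_change[of J i q' q] other step[OF i] assms(1) by auto
next
  case False
  then have "potential J q' = potential J q" using other by (simp add: potential_def)
  then show ?thesis by simp
qed

lemma strict_mono_letter_map: "strict_mono (letter_map s)"
proof -
  obtain x e where s: "s = (x, e)" by (cases s)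
  show ?thesis
    by (cases x; cases e) (auto simp: s strict_mono_def join_map_def cut_map_def)
qed

text \<open>
  The two remaining letters are inverse to the two maps treated above, and the bound is symmetric.
\<close>

lemma potential_letter:
  assumes "finite J" "strict_mono q"
  shows "\<bar>potential J (\<lambda>i. letter_map s (q i)) - potential J q\<bar> \<le> 1"
proof -
  have right: "\<bar>potential J (\<lambda>i. q i - 1) - potential J q\<bar> \<le> 1" if "strict_mono q" for q
    by (rule potential_step_le[OF assms(1) that cost_shift cost_shift_step])
  have join: "\<bar>potential J (\<lambda>i. join_map (q i)) - potential J q\<bar> \<le> 1" if "strict_mono q" for q
    by (rule potential_step_le[OF assms(1) that cost_join[OF that] cost_join_step])
  obtain x e where s: "s = (x, e)" by (cases s)
  have *: "strict_mono (\<lambda>i. letter_map s (q i))"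
    using assms(2) strict_mono_letter_map by (simp add: strict_mono_def)
  show ?thesis
    using right[OF assms(2)] join[OF assms(2)] right[OF *] join[OF *]
    by (cases x; cases e) (auto simp: s abs_minus_commute)
qed

lemma strict_mono_word_map: "strict_mono (word_map u)"
  by (induction u) (auto simp: strict_mono_def strict_mono_less[OF strict_mono_letter_map])

lemma potential_word:
  assumes "finite J" "strict_mono q"
  shows "\<bar>potential J (\<lambda>i. word_map u (q i)) - potential J q\<bar> \<le> length u"
  using assms(2)
proof (induction u arbitrary: q)
  case (Cons s u)
  have "strict_mono (\<lambda>i. letter_map s (q i))"
    using Cons.prems strict_mono_letter_map by (simp add: strict_mono_def)
  from Cons.IH[OF this] potential_letter[OF assms(1) Cons.prems, of s] show ?case by simp
qed simp

lemma potential_le_word_length: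
  assumes "finite J"
  shows "potential J (\<lambda>i. word_map u (of_int i)) \<le> word_length thompson_F {F_x0, F_x1} (F_elem u)"
proof -
  obtain v where v: "length v = word_length thompson_F {F_x0, F_x1} (F_elem u)" "F_elem v = F_elem u"
    by (rule word_length_attained)
  have "cost of_int j = 0" for j by (auto simp: cost_def)
  then have "potential J (\<lambda>i. of_int i) = 0" by (simp add: potential_def)
  moreover have "strict_mono (\<lambda>i. real_of_int i)" by (simp add: strict_mono_def)
  ultimately have "potential J (\<lambda>i. word_map v (of_int i)) \<le> length v"
    using potential_word[OF assms, of "\<lambda>i. of_int i" v] by simp
  then show ?thesis unfolding F_elem_word_map[OF v(2)] v(1) .
qed

section \<open>Commuting elements\<close>

text \<open>
  Conjugation by powers of \<open>x\<close> is an additive action of the integers by automorphisms.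
\<close>

definition (in group) shift :: "'a \<Rightarrow> int \<Rightarrow> 'a \<Rightarrow> 'a" where
  "shift x n y = x [^] (- n) \<otimes> y \<otimes> x [^] n"

context group
begin

lemma int_pow_combine:
  assumes "x \<in> carrier G" "z \<in> carrier G"
  shows "x [^] (m::int) \<otimes> (x [^] n \<otimes> z) = x [^] (m + n) \<otimes> z"
  using assms by (simp add: int_pow_mult m_assoc)

lemma shift_closed [simp]: "x \<in> carrier G \<Longrightarrow> y \<in> carrier G \<Longrightarrow> shift x n y \<in> carrier G"
  by (simp add: shift_def)

lemma shift_mult:
  assumes "x \<in> carrier G" "y \<in> carrier G" "z \<in> carrier G"
  shows "shift x n (y \<otimes> z) = shift x n y \<otimes> shift x n z"
  using assms by (simp add: shift_def m_assoc int_pow_combine)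

lemma shift_shift:
  assumes "x \<in> carrier G" "y \<in> carrier G"
  shows "shift x m (shift x n y) = shift x (m + n) y"
proof -
  have "shift x m (shift x n y) = x [^] (- m - n) \<otimes> (y \<otimes> (x [^] n \<otimes> x [^] m))"
    using assms by (simp add: shift_def m_assoc int_pow_combine)
  then show ?thesis using assms by (simp add: shift_def m_assoc int_pow_mult[symmetric] add.commute)
qed

lemma shift_1:
  assumes "x \<in> carrier G" "y \<in> carrier G"
  shows "shift x 1 y = inv x \<otimes> y \<otimes> x"
  using assms by (simp add: shift_def int_pow_neg)

text \<open>
  The relators of \<open>F\<close> say that \<open>x0 x1\<^sup>-\<^sup>1\<close> commutes with conjugates \<open>s\<close> of \<open>x1\<close>. Solved for \<open>b s\<close>, this turns
  into the form in which the relations of \<open>F\<close> are usually read: conjugating by \<open>b\<close> has the same effect on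
  \<open>s\<close> as shifting it by one place.
\<close>

lemma commute_iff_shift:
  assumes "x \<in> carrier G" "b \<in> carrier G" "s \<in> carrier G"
  shows "(x \<otimes> b) \<otimes> s = s \<otimes> (x \<otimes> b) \<longleftrightarrow> b \<otimes> s = shift x 1 s \<otimes> b"
proof -
  have "x \<otimes> (shift x 1 s \<otimes> b) = s \<otimes> (x \<otimes> b)"
    using assms by (simp add: shift_1 m_assoc[symmetric])
  then show ?thesis using assms Units_l_cancel[of x "b \<otimes> s" "shift x 1 s \<otimes> b"] by (simp add: m_assoc)
qed

text \<open>
  Write \<open>B n\<close> for the shift of \<open>b\<close> by \<open>n\<close>. By the previous lemma the claim is \<open>b (B n) = B (n + 1) b\<close>, and
  shifting an instance of this gives \<open>B j (B (j + n)) = B (j + n + 1) (B j)\<close>. For \<open>n \<ge> 3\<close> the element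
  \<open>B n\<close> is the conjugate of \<open>B (n - 1)\<close> by \<open>B 1\<close>, and conjugation by \<open>b\<close> takes this to the conjugate of \<open>B n\<close>
  by \<open>B 2\<close>, which is \<open>B (n + 1)\<close>. The two shifted instances are those for \<open>n - 2\<close>; so two starting values,
  the two relators, suffice.
\<close>

lemma commute_with_all_shifts:
  assumes [simp]: "x \<in> carrier G" "b \<in> carrier G"
    and rel: "(x \<otimes> b) \<otimes> shift x 1 b = shift x 1 b \<otimes> (x \<otimes> b)"
      "(x \<otimes> b) \<otimes> shift x 2 b = shift x 2 b \<otimes> (x \<otimes> b)"
    and "n \<ge> 1"
  shows "(x \<otimes> b) \<otimes> shift x (int n) b = shift x (int n) b \<otimes> (x \<otimes> b)"
proof -
  define B where "B m = shift x (int m) b" for m :: nat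
  have B [simp]: "B m \<in> carrier G" for m by (simp add: B_def)
  have b: "B 0 = b" by (simp add: B_def shift_def)
  have shB: "shift x (int j) (B m) = B (j + m)" for j m
    by (simp add: B_def shift_shift)
  have iff: "(x \<otimes> b) \<otimes> B m = B m \<otimes> (x \<otimes> b) \<longleftrightarrow> b \<otimes> B m = B (Suc m) \<otimes> b" for m
    using commute_iff_shift[of x b "B m"] shB[of 1 m] by simp
  have up: "B j \<otimes> B (j + m) = B (j + Suc m) \<otimes> B j" if "b \<otimes> B m = B (Suc m) \<otimes> b" for j m
  proof -
    have "shift x (int j) (B 0 \<otimes> B m) = shift x (int j) (B (Suc m) \<otimes> B 0)" using that b by simp
    then show ?thesis by (simp add: shift_mult shB del: of_nat_add)
  qed
  have "b \<otimes> B m = B (Suc m) \<otimes> b" if "m \<ge> 1" for m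
    using that
  proof (induction m rule: less_induct)
    case (less m)
    consider "m = 1" | "m = 2" | "m \<ge> 3" using less.prems by linarith
    then show ?case
    proof cases
      case 1
      then show ?thesis using rel(1) iff[of 1] by (simp add: B_def)
    next
      case 2
      then show ?thesis using rel(2) iff[of 2] by (simp add: B_def)
    next
      case 3
      then obtain i where i: "m = Suc (Suc i)" "i \<ge> 1"
        by (metis One_nat_def Suc_le_D Suc_le_mono numeral_3_eq_3)
      have 1: "b \<otimes> B 1 = B 2 \<otimes> b" "b \<otimes> B (Suc i) = B m \<otimes> b" "b \<otimes> B i = B (Suc i) \<otimes> b"
        using less.IH[of 1, unfolded Suc_1] less.IH[of "Suc i"] less.IH[of i] i by simp_all
      have 2: "B 1 \<otimes> B (Suc i) = B m \<otimes> B 1" "B 2 \<otimes> B m = B (Suc m) \<otimes> B 2"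
        using up[OF 1(3), of 1] up[OF 1(3), of 2] i by simp_all
      have "(b \<otimes> B m) \<otimes> B 1 = b \<otimes> (B 1 \<otimes> B (Suc i))" by (simp only: 2(1)) (simp add: m_assoc)
      also have "\<dots> = B 2 \<otimes> (b \<otimes> B (Suc i))" by (simp add: m_assoc[symmetric] 1(1)[simplified])
      also have "\<dots> = (B 2 \<otimes> B m) \<otimes> b" by (simp add: 1(2) m_assoc)
      also have "\<dots> = B (Suc m) \<otimes> (b \<otimes> B 1)" by (simp add: 2(2) 1(1)[simplified] m_assoc)
      also have "\<dots> = (B (Suc m) \<otimes> b) \<otimes> B 1" by (simp add: m_assoc)
      finally show ?thesis by simp
    qed
  qed
  then show ?thesis using iff[of n] \<open>n \<ge> 1\<close> by (simp add: B_def)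
qed

end

section \<open>The two halves of the seesaw words\<close>

definition x0_word :: "int \<Rightarrow> (F_gen \<times> bool) list" where
  "x0_word l = (if l \<ge> 0 then replicate (nat l) (X0, True) else replicate (nat (- l)) (X0, False))"

lemma F_x_carrier [simp]: "F_x0 \<in> carrier thompson_F" "F_x1 \<in> carrier thompson_F"
  using F_elem_carrier F_elem_x0 F_elem_x1 by metis+

lemma F_elem_x0_word: "F_elem (x0_word l) = F_x0 [^]\<^bsub>thompson_F\<^esub> l"
proof -
  interpret group thompson_F by (rule group_thompson_F)
  have 1: "F_elem (replicate n s) = F_elem [s] [^]\<^bsub>thompson_F\<^esub> n" for n s
  proof (induction n)
    case (Suc n)
    have "replicate (Suc n) s = replicate n s @ [s]" by (simp add: replicate_append_same)
    then show ?case using Suc by (simp only: F_elem_append) simp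
  qed (simp add: F_elem_Nil)
  show ?thesis
  proof (cases "l \<ge> 0")
    case True
    have "F_x0 [^]\<^bsub>thompson_F\<^esub> l = F_x0 [^]\<^bsub>thompson_F\<^esub> nat l"
      using True int_pow_int[of thompson_F F_x0 "nat l"] by (simp only: int_nat_eq if_True)
    moreover have "x0_word l = replicate (nat l) (X0, True)" using True by (simp only: x0_word_def if_True)
    ultimately show ?thesis by (simp only: 1 F_elem_x0)
  next
    case False
    have "F_x0 [^]\<^bsub>thompson_F\<^esub> l = (inv\<^bsub>thompson_F\<^esub> F_x0) [^]\<^bsub>thompson_F\<^esub> nat (- l)"
      using False int_pow_neg_int[of F_x0 "nat (- l)"] nat_pow_inv[of F_x0 "nat (- l)"] F_x_carrier
      by simp
    moreover have "x0_word l = replicate (nat (- l)) (X0, False)" using False by (simp only: x0_word_def if_False)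
    ultimately show ?thesis by (simp only: 1 F_elem_inverse F_elem_x0)
  qed
qed

lemma length_x0_word [simp]: "int (length (x0_word l)) = \<bar>l\<bar>"
  by (simp add: x0_word_def)

lemma word_map_x0_word [simp]: "word_map (x0_word l) t = t + of_int l"
proof -
  have "word_map (replicate n (X0, True)) t = t + n" for n t by (induction n arbitrary: t) auto
  moreover have "word_map (replicate n (X0, False)) t = t - n" for n t by (induction n arbitrary: t) auto
  ultimately show ?thesis by (simp add: x0_word_def)
qed

text \<open>
  The pointer walks to the right and joins the leaves \<open>2 i\<close> and \<open>2 i + 1\<close> for \<open>i = 0, \<dots>, k\<close>; it stops at
  the last of these pairs.
\<close>

definition joins :: "nat \<Rightarrow> (F_gen \<times> bool) list" where
  "joins k = concat (replicate k [(X1, False), (X0, False)]) @ [(X1, False)]"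

definition right_part :: "nat \<Rightarrow> (F_gen \<times> bool) list" where
  "right_part k = joins k @ x0_word (int k)"

text \<open>
  One join, of the leaves in the places \<open>- k - 1\<close> and \<open>- k\<close>. Afterwards \<open>k\<close> moves are enough to return to
  the origin, because the joined tree counts as one.
\<close>

definition left_part :: "nat \<Rightarrow> (F_gen \<times> bool) list" where
  "left_part k = x0_word (int k + 1) @ [(X1, False)] @ x0_word (- int k)"

lemma F_elem_word_inv: "F_elem (word_inv u) = inv\<^bsub>thompson_F\<^esub> F_elem u"
proof -
  interpret group thompson_F by (rule group_thompson_F)
  show ?thesis
    using F_elem_free_eq[OF free_eq_word_inv[of u]]
    by (intro inv_equality[symmetric]) (simp_all add: F_elem_append F_elem_Nil)
qed

lemma F_elem_relator:
  assumes "free_rel `` {z} \<in> F_relators" shows "F_elem z = \<one>\<^bsub>thompson_F\<^esub>"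
proof -
  interpret free: group "free_group :: (F_gen \<times> bool) list set monoid" by (rule group_free_group)
  let ?N = "normal_closure free_group F_relators"
  let ?r = "free_rel `` {z}"
  have "\<one>\<^bsub>free_group\<^esub> \<otimes>\<^bsub>free_group\<^esub> ?r \<otimes>\<^bsub>free_group\<^esub> inv\<^bsub>free_group\<^esub> \<one>\<^bsub>free_group\<^esub> = ?r"
    by simp
  then have "?r \<in> ?N" unfolding normal_closure_def using assms
    by (intro generate.incl) (metis (mono_tags, lifting) free.one_closed mem_Collect_eq)
  then have "F_elem z = ?N"
    unfolding F_elem_def by (intro subgroup.rcos_const normal_imp_subgroup normal_F_relators group_free_group)
  then show ?thesis by (simp add: thompson_F_def presented_group_def FactGroup_def)
qed

lemma F_elem_commute:
  assumes "free_rel `` {u @ v @ word_inv u @ word_inv v} \<in> F_relators"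
  shows "F_elem u \<otimes>\<^bsub>thompson_F\<^esub> F_elem v = F_elem v \<otimes>\<^bsub>thompson_F\<^esub> F_elem u"
proof -
  interpret group thompson_F by (rule group_thompson_F)
  have "(F_elem u \<otimes>\<^bsub>thompson_F\<^esub> F_elem v) \<otimes>\<^bsub>thompson_F\<^esub> inv\<^bsub>thompson_F\<^esub> (F_elem v \<otimes>\<^bsub>thompson_F\<^esub> F_elem u) = \<one>\<^bsub>thompson_F\<^esub>"
    using F_elem_relator[OF assms] by (simp add: F_elem_append F_elem_word_inv inv_mult_group m_assoc)
  then show ?thesis by (metis F_elem_carrier inv_equality inv_inv m_closed inv_closed)
qed

text \<open>
  The left half is a conjugate of \<open>c = x0 x1\<^sup>-\<^sup>1\<close>, and the right half is the product of the shifts of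
  \<open>b = x1\<^sup>-\<^sup>1\<close> by \<open>0, \<dots>, k\<close>. After a further shift by \<open>k \<ge> 1\<close>, which takes the left half to \<open>c\<close>, all factors of the
  right half are shifts of \<open>b\<close> by positive amounts, and \<open>c\<close> commutes with each of these.
\<close>

lemma left_right_commute: 
  assumes "k \<ge> 1"
  shows "F_elem (left_part k @ right_part k) = F_elem (right_part k @ left_part k)"
proof -
  interpret group thompson_F by (rule group_thompson_F)
  let ?b = "F_elem [(X1, False)]"
  let ?c = "F_x0 \<otimes>\<^bsub>thompson_F\<^esub> ?b"
  have c: "?c = F_elem [(X0, True), (X1, False)]"
    using F_elem_append[of "[(X0, True)]" "[(X1, False)]"] by (simp add: F_elem_x0)
  have inv_comm: "?c \<otimes>\<^bsub>thompson_F\<^esub> inv\<^bsub>thompson_F\<^esub> y = inv\<^bsub>thompson_F\<^esub> y \<otimes>\<^bsub>thompson_F\<^esub> ?c"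
    if "?c \<otimes>\<^bsub>thompson_F\<^esub> y = y \<otimes>\<^bsub>thompson_F\<^esub> ?c" "y \<in> carrier thompson_F" for y
    using that by (metis F_elem_carrier c inv_closed inv_solve_left inv_solve_right m_assoc m_closed)
  have word: "shift F_x0 n ?b = F_elem (x0_word (- n) @ [(X1, False)] @ x0_word n)" for n
    by (simp add: shift_def F_elem_append F_elem_x0_word m_assoc del: append_Cons append_Nil)
  have rel: "?c \<otimes>\<^bsub>thompson_F\<^esub> shift F_x0 n ?b = shift F_x0 n ?b \<otimes>\<^bsub>thompson_F\<^esub> ?c" if "n = 1 \<or> n = 2" for n
  proof -
    let ?v = "x0_word (- n) @ [(X1, True)] @ x0_word n"
    have "free_rel `` {[(X0, True), (X1, False)] @ ?v @ word_inv [(X0, True), (X1, False)] @ word_inv ?v} \<in> F_relators"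
      using that by (auto simp: F_relators_words Let_def x0_word_def numeral_2_eq_2)
    from F_elem_commute[OF this] have "?c \<otimes>\<^bsub>thompson_F\<^esub> F_elem ?v = F_elem ?v \<otimes>\<^bsub>thompson_F\<^esub> ?c"
      by (simp add: c)
    moreover have "word_inv ?v = x0_word (- n) @ [(X1, False)] @ x0_word n"
      using that by (auto simp: x0_word_def word_inv_def numeral_2_eq_2)
    ultimately show ?thesis using inv_comm[of "F_elem ?v"] by (simp add: word flip: F_elem_word_inv)
  qed
  have comm: "?c \<otimes>\<^bsub>thompson_F\<^esub> shift F_x0 (int n) ?b = shift F_x0 (int n) ?b \<otimes>\<^bsub>thompson_F\<^esub> ?c" if "n \<ge> 1" for n
    by (rule commute_with_all_shifts) (use rel[of 1] rel[of 2] that in auto)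
  have "?c \<otimes>\<^bsub>thompson_F\<^esub> shift F_x0 (int n) (F_elem (right_part m)) =
      shift F_x0 (int n) (F_elem (right_part m)) \<otimes>\<^bsub>thompson_F\<^esub> ?c" if "n \<ge> 1" for n m
    using that
  proof (induction m arbitrary: n)
    case 0
    then show ?case using comm[of n] by (simp add: right_part_def joins_def x0_word_def)
  next
    case (Suc m)
    let ?s = "shift F_x0 (int n) ?b" and ?t = "shift F_x0 (int (Suc n)) (F_elem (right_part m))"
    have "right_part (Suc m) = [(X1, False)] @ x0_word (- 1) @ right_part m @ x0_word 1"
      by (simp add: right_part_def joins_def x0_word_def replicate_append_same nat_add_distrib)
    then have "F_elem (right_part (Suc m)) = ?b \<otimes>\<^bsub>thompson_F\<^esub> shift F_x0 1 (F_elem (right_part m))"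
      by (simp add: shift_def F_elem_append F_elem_x0_word int_pow_neg m_assoc del: append_Cons append_Nil)
    then have *: "shift F_x0 (int n) (F_elem (right_part (Suc m))) = ?s \<otimes>\<^bsub>thompson_F\<^esub> ?t"
      by (simp add: shift_mult shift_shift add.commute)
    have "?c \<otimes>\<^bsub>thompson_F\<^esub> (?s \<otimes>\<^bsub>thompson_F\<^esub> ?t) = ?s \<otimes>\<^bsub>thompson_F\<^esub> (?c \<otimes>\<^bsub>thompson_F\<^esub> ?t)"
      using comm[OF Suc.prems] by (simp add: m_assoc[symmetric])
    also have "\<dots> = ?s \<otimes>\<^bsub>thompson_F\<^esub> ?t \<otimes>\<^bsub>thompson_F\<^esub> ?c"
      using Suc.IH[of "Suc n"] by (simp add: m_assoc)
    finally show ?case unfolding * .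
  qed
  from this[OF assms, of k]
  have "shift F_x0 (- int k) (?c \<otimes>\<^bsub>thompson_F\<^esub> shift F_x0 (int k) (F_elem (right_part k))) =
    shift F_x0 (- int k) (shift F_x0 (int k) (F_elem (right_part k)) \<otimes>\<^bsub>thompson_F\<^esub> ?c)" by simp
  then have "shift F_x0 (- int k) ?c \<otimes>\<^bsub>thompson_F\<^esub> F_elem (right_part k) =
    F_elem (right_part k) \<otimes>\<^bsub>thompson_F\<^esub> shift F_x0 (- int k) ?c"
    by (simp add: shift_mult shift_shift) (simp add: shift_def)
  moreover have "shift F_x0 (- int k) ?c = F_elem (left_part k)"
    by (simp add: shift_def left_part_def F_elem_append F_elem_x0_word int_pow_mult m_assoc
        del: append_Cons append_Nil)
  ultimately show ?thesis by (simp add: F_elem_append)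
qed

section \<open>The seesaw words\<close>

definition seesaw_F :: "nat \<Rightarrow> (F_gen \<times> bool) list" where
  "seesaw_F k = left_part k @ right_part k"

text \<open>
  The images of the integers under the action of \<open>seesaw_F k\<close> for \<open>k \<ge> 1\<close>. The gap \<open>- k\<close> and the odd gaps
  from \<open>1\<close> to \<open>2 k + 1\<close> are closed.
\<close>

definition seesaw_points :: "nat \<Rightarrow> int \<Rightarrow> real" where
  "seesaw_points k j =
    (if j \<le> - int k - 1 then of_int j + 1
     else if j = - int k then 1 / 2 - real k
     else if j \<le> 0 then of_int j
     else if j \<le> 2 * int k + 2 then of_int j / 2
     else of_int j - real k - 1)"

lemma word_map_join_steps:
  "word_map (concat (replicate k [(X1, False), (X0, False)])) t =
    (if t \<le> 0 then t - k else if t \<le> 2 * k then t / 2 - k else t - 2 * k)"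
  by (induction k arbitrary: t) (auto simp: join_map_def field_simps)

lemma word_map_right_part:
  "word_map (right_part k) t = (if t \<le> 0 then t else if t \<le> 2 * k + 2 then t / 2 else t - k - 1)"
  by (auto simp: right_part_def joins_def word_map_join_steps join_map_def field_simps)

lemma word_map_left_part:
  "word_map (left_part k) t =
    (if t \<le> - real k - 1 then t + 1 else if t \<le> 1 - real k then (t + 1 - real k) / 2 else t)"
  by (auto simp: left_part_def join_map_def field_simps)

lemma word_map_seesaw:
  assumes "k \<ge> 1" shows "word_map (seesaw_F k) (of_int j) = seesaw_points k j"
proof -
  consider "j \<le> - int k - 1" | "j = - int k" | "j \<ge> 1 - int k" by linarith
  then have left: "word_map (left_part k) (of_int j) =
    (if j \<le> - int k - 1 then of_int j + 1 else if j = - int k then 1 / 2 - real k else of_int j)"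
    by cases (auto simp: word_map_left_part)
  show ?thesis
    using assms by (auto simp: seesaw_F_def left word_map_right_part seesaw_points_def)
qed

lemma strict_mono_seesaw:
  assumes "k \<ge> 1" shows "strict_mono (\<lambda>j. seesaw_points k j + of_int l)"
  unfolding word_map_seesaw[OF assms, symmetric]
  using strict_mono_word_map[of "seesaw_F k"] by (simp add: strict_mono_def)

text \<open>
  These gaps carry the whole cost of the seesaw word.
\<close>

abbreviation seesaw_window :: "nat \<Rightarrow> int set" where
  "seesaw_window k \<equiv> {- int k..2 * int k + 1}"

text \<open>
  The \<open>k + 1\<close> gaps on the left cost \<open>2\<close> each: the closed one for its join and a move, the open ones
  because the closed one lies beyond them. On the right there are \<open>k + 1\<close> closed gaps of cost \<open>1\<close>, and \<open>k\<close>
  open gaps of cost \<open>2\<close>, beyond each of which there is another pair.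
\<close>

lemma potential_seesaw: "potential (seesaw_window k) (seesaw_points k) \<ge> 5 * int k + 3"
proof -
  let ?q = "seesaw_points k"
  have half: "of_int n + 1 / 2 \<notin> (\<int> :: real set)" for n :: int
  proof
    assume "of_int n + 1 / 2 \<in> (\<int> :: real set)"
    then obtain m where "of_int n + 1 / 2 = (of_int m :: real)" by (elim Ints_cases)
    then have "real_of_int (2 * n + 1) = of_int (2 * m)" by simp
    then have "2 * n + 1 = 2 * m" unfolding of_int_eq_iff .
    then show False by presburger
  qed
  have left: "cost ?q j \<ge> 2" if "- int k \<le> j" "j \<le> 0" for j
  proof (cases "j = - int k")
    case True
    then have "?q j = of_int (- int k) + 1 / 2" by (simp add: seesaw_points_def)
    then have "?q j \<notin> \<int>" using half by metis
    then show ?thesis using that by (simp add: cost_def)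
  next
    case False
    then have "?q j = of_int j" using that by (simp add: seesaw_points_def)
    moreover have "\<exists>i\<le>j. ?q i \<noteq> of_int j + of_int (i - j)"
      using that by (intro exI[of _ "- int k"]) (simp add: seesaw_points_def)
    ultimately show ?thesis using that by (auto simp: cost_def)
  qed
  have odd: "cost ?q (2 * int n + 1) \<ge> 1" if "n \<le> k" for n
  proof -
    have "?q (2 * int n + 1) = of_int (int n) + 1 / 2"
      using that by (simp add: seesaw_points_def add_divide_distrib)
    then have "?q (2 * int n + 1) \<notin> \<int>" using half by metis
    then show ?thesis by (simp add: cost_def)
  qed
  have even: "cost ?q (2 * int n + 2) \<ge> 2" if "n < k" for n
  proof -
    let ?j = "2 * int n + 2"
    have q: "?q ?j = of_int (int n + 1)" using that by (simp add: seesaw_points_def add_divide_distrib)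
    have "\<not> (\<forall>i\<ge>?j. ?q i = ?q ?j + of_int (i - ?j))"
    proof
      assume "\<forall>i\<ge>?j. ?q i = ?q ?j + of_int (i - ?j)"
      then have "?q (?j + 1) = ?q ?j + of_int (?j + 1 - ?j)" by (metis zle_add1_eq_le zless_add1_eq)
      then show False using that by (simp add: seesaw_points_def)
    qed
    moreover have "?q ?j \<in> \<int>" "?q ?j > 0" unfolding q by auto
    ultimately show ?thesis by (simp add: cost_def)
  qed
  have right_sum: "(\<Sum>j\<in>{1..2 * int n + 1}. cost ?q j) \<ge> 3 * int n + 1" if "n \<le> k" for n
    using that
  proof (induction n)
    case 0
    then show ?case using odd[of 0] by simp
  next
    case (Suc n)
    have "{1..2 * int (Suc n) + 1} = insert (2 * int n + 3) (insert (2 * int n + 2) {1..2 * int n + 1})"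
      by auto
    moreover have "cost ?q (2 * int n + 3) \<ge> 1" using odd[of "Suc n"] Suc.prems by (simp add: algebra_simps)
    moreover have "cost ?q (2 * int n + 2) \<ge> 2" using even[of n] Suc.prems by simp
    ultimately show ?case using Suc by simp
  qed
  have left_sum: "(\<Sum>j\<in>{- int k..0}. cost ?q j) \<ge> (\<Sum>j\<in>{- int k..0}. 2)"
    by (rule sum_mono) (use left in auto)
  have "potential (seesaw_window k) ?q = (\<Sum>j\<in>{- int k..0}. cost ?q j) + (\<Sum>j\<in>{1..2 * int k + 1}. cost ?q j)"
    unfolding potential_def by (subst sum.union_disjoint[symmetric]) (auto intro!: sum.cong)
  then show ?thesis using left_sum right_sum[of k] by simp
qed

text \<open>
  Each of the \<open>\<bar>l\<bar>\<close> letters of \<open>x0\<^sup>l\<close> lowers the potential by at most \<open>1\<close>.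
\<close>

lemma potential_seesaw_shift:
  assumes "k \<ge> 1"
  shows "potential (seesaw_window k) (\<lambda>j. seesaw_points k j + of_int l) \<ge> 5 * int k + 3 - \<bar>l\<bar>"
  using potential_word[of "seesaw_window k" "\<lambda>j. seesaw_points k j + of_int 0" "x0_word l"]
    potential_seesaw[of k] strict_mono_seesaw[OF assms, of 0] by simp

text \<open>
  The odd numerator and the exponent in the definition of \<open>snug\<close> are unique, so \<open>1 / 2\<close> can only be
  written with both equal to \<open>1\<close>.
\<close>

lemma not_snug_half: "t < 1 \<Longrightarrow> \<not> snug (1 / 2) t"
proof
  assume t: "t < 1" and "snug (1 / 2) t"
  then obtain a :: int and i :: nat where a: "odd a" "1 / 2 = real_of_int a / 2 ^ i"
    "real_of_int (a + 1) / 2 ^ i \<le> t" unfolding snug_def by blast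
  have "real_of_int (2 ^ i) = of_int (2 * a)" using a(2) by (simp add: field_simps)
  then have i: "2 ^ i = 2 * a" unfolding of_int_eq_iff .
  then obtain n where n: "i = Suc n" by (cases i) (auto, presburger)
  then have "a = 2 ^ n" using i by simp
  then have "n = 0" using a(1) by (cases n) auto
  then show False using a(3) t n \<open>a = 2 ^ n\<close> by simp
qed

lemma snug_half: "snug (1 / 2) 1"
  unfolding snug_def by (intro exI[of _ 1] exI[of _ "1::nat"]) simp

text \<open>
  On the right (\<open>l \<le> 0\<close>) the gap next to the pointer is open, with cost at most \<open>2\<close>. Behind it there is a
  pair, so it is not snug once it is closed, and its cost becomes \<open>3\<close>. On the left the gap is crossed
  once in any case, and closing it adds the join to the cost.
\<close>

lemma potential_join_seesaw:
  assumes "\<bar>l\<bar> < int k"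
  shows "potential (seesaw_window k) (\<lambda>j. join_map (seesaw_points k j + of_int l)) \<ge> 
    potential (seesaw_window k) (\<lambda>j. seesaw_points k j + of_int l)"
proof -
  let ?r = "\<lambda>j. seesaw_points k j + of_int l"
  have k: "k \<ge> 1" using assms by linarith
  have "\<exists>i. ?r i = 1 \<and> cost ?r i \<le> cost (\<lambda>j. join_map (?r j)) i"
  \<comment> \<open>A multiplication by \<open>x0\<^sup>l\<close> moves the pointer to the right if \<open>l\<close> is negative.\<close>
  proof (cases "l \<le> 0")
    case True
    let ?i = "2 * (1 - l)"
    have r: "?r ?i = 1" using True assms by (simp add: seesaw_points_def diff_divide_distrib)
    moreover have "?r (?i + 1) = 3 / 2"
      using True assms by (simp add: seesaw_points_def add_divide_distrib diff_divide_distrib)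
    then have "\<not> snug (1 / 2) (join_map (?r (?i + 1)))" by (intro not_snug_half) (simp add: join_map_def)
    then have "cost (\<lambda>j. join_map (?r j)) ?i = 3"
      using r True by (subst cost_half) (simp_all add: join_map_def)
    moreover have "cost ?r ?i \<le> 2" unfolding cost_one[of ?r, OF r] by simp
    ultimately show ?thesis by (intro exI[of _ ?i]) simp
  next
    case False
    have r: "?r (1 - l) = 1" using False assms by (simp add: seesaw_points_def)
    moreover have "cost (\<lambda>j. join_map (?r j)) (1 - l) = 2"
      using r False by (subst cost_half) (simp_all add: join_map_def)
    moreover have "cost ?r (1 - l) = 1" using cost_one[of ?r, OF r] False by simp
    ultimately show ?thesis by (intro exI[of _ "1 - l"]) simp
  qed
  then obtain i where "?r i = 1" "cost ?r i \<le> cost (\<lambda>j. join_map (?r j)) i" by blast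
  then show ?thesis
    using potential_join[OF strict_mono_seesaw[OF k, of l], of "seesaw_window k" i] by (simp split: if_splits)
qed

text \<open>
  On the right (\<open>l \<le> 0\<close>) cutting reopens the gap inside a pair. This takes back one join, but now the gap
  lies between the pointer and the next pair and has to be crossed twice, so its cost rises from \<open>1\<close> to
  \<open>2\<close>. On the left the current tree is a single leaf, and no gap \<open>j\<close> is affected.
\<close>

lemma potential_cut_seesaw:
  assumes "\<bar>l\<bar> < int k"
  shows "potential (seesaw_window k) (\<lambda>j. cut_map (seesaw_points k j + of_int l)) \<ge> 
    potential (seesaw_window k) (\<lambda>j. seesaw_points k j + of_int l)"
proof -
  let ?r = "\<lambda>j. seesaw_points k j + of_int l"
  have k: "k \<ge> 1" using assms by linarith
  let ?c = "\<lambda>j. cut_map (?r j)"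
  have c: "strict_mono ?c"
    using strict_mono_seesaw[OF k, of l] strict_mono_letter_map[of "(X1, True)"] by (simp add: strict_mono_def)
  show ?thesis
  proof (cases "l \<le> 0")
    case True
    let ?i = "1 - 2 * l"
    have r: "?r ?i = 1 / 2" "?r (?i + 1) = 1" "?r (?i + 2) = 3 / 2"
      using True assms by (simp_all add: seesaw_points_def add_divide_distrib diff_divide_distrib)
    then have "cost ?r ?i = 1" using True snug_half by (subst cost_half) simp_all
    moreover have ci: "?c ?i = 1" using r(1) by (simp add: cut_map_def)
    have "\<not> (\<forall>i\<ge>?i. ?c i = 1 + of_int (i - ?i))"
    proof
      assume "\<forall>i\<ge>?i. ?c i = 1 + of_int (i - ?i)"
      then have "?c (?i + 2) = 1 + of_int (?i + 2 - ?i)" by (rule allE[of _ "?i + 2"]) simp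
      then show False unfolding r(3) by (simp add: cut_map_def)
    qed
    then have "cost ?c ?i = 2" using True unfolding cost_one[of ?c, OF ci] by simp
    ultimately show ?thesis using potential_join[OF c _ ci, of "seesaw_window k"] by (simp split: if_splits)
  next
    case False
    have half: "real_of_int n \<noteq> 1 / 2" for n
    proof
      assume "real_of_int n = 1 / 2"
      then have "real_of_int (2 * n) = of_int 1" by simp
      then have "2 * n = 1" unfolding of_int_eq_iff .
      then show False by presburger
    qed
    have not_half: "?r j \<noteq> 1 / 2" for j
      using False assms half[of "j + 1 + l"] half[of "j + l"] by (auto simp: seesaw_points_def)
    have "?c j \<noteq> 1" for j using not_half[of j] by (auto simp: cut_map_def)
    then have "cost ?r j = cost ?c j" for j using cost_join[OF c, of j] by simp
    then show ?thesis by (simp add: potential_def)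
  qed
qed

abbreviation F_length :: "(F_gen \<times> bool) list set set \<Rightarrow> nat" where
  "F_length \<equiv> word_length thompson_F {F_x0, F_x1}"

text \<open>
  For the upper bound the half towards which the pointer finally moves is built last, so that the
  moves back towards the origin at the end of that half partly cancel against \<open>x0\<^sup>l\<close>.
\<close>

lemma length_seesaw_shift:
  assumes "k \<ge> 1" "\<bar>l\<bar> \<le> int k"
  shows "int (F_length (F_elem (seesaw_F k @ x0_word l))) = 5 * int k + 3 - \<bar>l\<bar>"
proof (rule antisym)
  have *: "F_elem (u @ x0_word m @ x0_word l) = F_elem (u @ x0_word (m + l))" for u m
  proof -
    interpret group thompson_F by (rule group_thompson_F)
    show ?thesis by (simp add: F_elem_append F_elem_x0_word int_pow_mult)
  qed
  have "length (concat (replicate n [(X1, False), (X0, False)])) = 2 * n" for n by (induction n) auto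
  then have len: "length (joins k) = 2 * k + 1" by (simp add: joins_def)
  have "\<exists>v. F_elem v = F_elem (seesaw_F k @ x0_word l) \<and> int (length v) \<le> 5 * int k + 3 - \<bar>l\<bar>"
  proof (cases "l \<le> 0")
    case True
    have "F_elem ((left_part k @ joins k) @ x0_word (int k + l)) = F_elem (seesaw_F k @ x0_word l)"
      using *[of "left_part k @ joins k" "int k"] by (simp add: seesaw_F_def right_part_def)
    then show ?thesis using True assms
      by (intro exI[of _ "(left_part k @ joins k) @ x0_word (int k + l)"]) (simp add: left_part_def len)
  next
    case False
    let ?u = "right_part k @ x0_word (int k + 1) @ [(X1, False)]"
    have "F_elem (seesaw_F k @ x0_word l) = F_elem (right_part k @ left_part k @ x0_word l)"
      using left_right_commute[OF assms(1)] by (simp add: seesaw_F_def F_elem_append flip: append_assoc)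
    then have "F_elem (?u @ x0_word (- int k + l)) = F_elem (seesaw_F k @ x0_word l)"
      using *[of ?u "- int k"] by (simp add: left_part_def)
    then show ?thesis using False assms
      by (intro exI[of _ "?u @ x0_word (- int k + l)"]) (simp add: right_part_def len)
  qed
  then obtain v where "F_elem v = F_elem (seesaw_F k @ x0_word l)" "int (length v) \<le> 5 * int k + 3 - \<bar>l\<bar>"
    by blast
  then show "int (F_length (F_elem (seesaw_F k @ x0_word l))) \<le> 5 * int k + 3 - \<bar>l\<bar>"
    using word_length_le[of v "seesaw_F k @ x0_word l"] by linarith
  show "5 * int k + 3 - \<bar>l\<bar> \<le> int (F_length (F_elem (seesaw_F k @ x0_word l)))"
    using potential_seesaw_shift[OF assms(1), of l]
      potential_le_word_length[of "seesaw_window k" "seesaw_F k @ x0_word l"]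
    by (simp add: word_map_seesaw[OF assms(1)])
qed

lemma length_seesaw_shift_x1:
  assumes "\<bar>l\<bar> < int k"
  shows "int (F_length (F_elem (seesaw_F k @ x0_word l @ [(X1, e)]))) \<ge> 5 * int k + 3 - \<bar>l\<bar>"
proof -
  have k: "k \<ge> 1" using assms by linarith
  show ?thesis
    using potential_seesaw_shift[OF k, of l] potential_cut_seesaw[OF assms] potential_join_seesaw[OF assms]
      potential_le_word_length[of "seesaw_window k" "seesaw_F k @ x0_word l @ [(X1, e)]"]
    by (cases e) (simp_all add: word_map_seesaw[OF k])
qed

theorem theorem4p1:
  shows "\<forall>K::int. K > 0 \<longrightarrow>
    (\<exists>k\<ge>K. \<exists>w\<in>carrier thompson_F. seesaw_word thompson_F {F_x0, F_x1} F_x0 k w)"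
proof (intro allI impI)
  interpret group thompson_F by (rule group_thompson_F)
  fix K :: int assume "K > 0"
  define k where "k = nat K"
  have k: "int k = K" "k \<ge> 1" using \<open>K > 0\<close> by (simp_all add: k_def)
  define w where "w = F_elem (seesaw_F k)"
  define p where "p l = w \<otimes>\<^bsub>thompson_F\<^esub> F_x0 [^]\<^bsub>thompson_F\<^esub> l" for l :: int
  have w: "w \<in> carrier thompson_F" by (simp add: w_def)
  have p: "p l = F_elem (seesaw_F k @ x0_word l)" for l
    by (simp add: p_def w_def F_elem_append F_elem_x0_word)
  have len: "int (F_length (p l)) = 5 * K + 3 - \<bar>l\<bar>" if "\<bar>l\<bar> \<le> K" for l
    using length_seesaw_shift[of k l] k that by (simp add: p)
  have x1: "int (F_length (p l \<otimes>\<^bsub>thompson_F\<^esub> F_elem [(X1, e)])) \<ge> 5 * K + 3 - \<bar>l\<bar>"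
    if "\<bar>l\<bar> < K" for l e
    using length_seesaw_shift_x1[of l k e] k that by (simp add: p F_elem_append[symmetric])
  \<comment> \<open>Multiplying by the inverse of the direction of swing leads back to the previous element of the
    row, which is one longer, so only the letters \<open>x1\<close> and its inverse need the estimate \<open>x1\<close>.\<close>
  have step: "p l \<otimes>\<^bsub>thompson_F\<^esub> F_x0 = p (l + 1)"
    "p l \<otimes>\<^bsub>thompson_F\<^esub> inv\<^bsub>thompson_F\<^esub> F_x0 = p (l - 1)" for l
    using w by (simp_all add: p_def int_pow_mult int_pow_diff m_assoc)
  have p0: "w = p 0" using w by (simp add: p_def)
  have gens: "gens_and_invs thompson_F {F_x0, F_x1} =
      {F_x0, inv\<^bsub>thompson_F\<^esub> F_x0, F_elem [(X1, True)], F_elem [(X1, False)]}"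
    by (simp add: gens_and_invs_F F_elem_x0 F_elem_inverse[of X0])
  have 1: "int (F_length (w \<otimes>\<^bsub>thompson_F\<^esub> h)) \<ge> int (F_length w)"
    if "h \<in> gens_and_invs thompson_F {F_x0, F_x1}" "h \<noteq> F_x0" "h \<noteq> inv\<^bsub>thompson_F\<^esub> F_x0" for h
    using that x1[of 0] len[of 0] \<open>K > 0\<close> by (auto simp: p0 gens)
  have 2: "int (F_length (p m \<otimes>\<^bsub>thompson_F\<^esub> h)) \<ge> int (F_length (p m))"
    if "m \<in> {1..K - 1}" "h \<in> gens_and_invs thompson_F {F_x0, F_x1}" "h \<noteq> F_x0" for m h
    using that x1[of m] len[of m] len[of "m - 1"] by (auto simp: step gens)
  have 3: "int (F_length (p (- m) \<otimes>\<^bsub>thompson_F\<^esub> h)) \<ge> int (F_length (p (- m)))"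
    if "m \<in> {1..K - 1}" "h \<in> gens_and_invs thompson_F {F_x0, F_x1}" "h \<noteq> inv\<^bsub>thompson_F\<^esub> F_x0" for m h
    using that x1[of "- m"] len[of "- m"] len[of "- m + 1"] by (auto simp: step gens)
  have "seesaw_word thompson_F {F_x0, F_x1} F_x0 K w"
    unfolding seesaw_word_def Let_def p_def[symmetric]
    using 1 2 3 w \<open>K > 0\<close> by (auto simp: p0 step len)
  then show "\<exists>k\<ge>K. \<exists>w\<in>carrier thompson_F. seesaw_word thompson_F {F_x0, F_x1} F_x0 k w"
    using w by blast
qed

end
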